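(* Let $X,Y$ be infinite-dimensional complex Hilbert spaces, let $W\in\mathcal{B}(Y,X)\setminus\{0\}$ and let $A\in\mathcal{B}(X,Y)$ be $W$g-Drazin invertible. Then the system of equations $$AWBWB=B\quad\text{and}\quad AWB=A^{\mathrm{cEP},W}WA$$ in the unknown $B\in\mathcal{B}(X,Y)$ is consistent and it has the unique solution given by $$B=\begin{bmatrix}(W_1A_1W_1)^{-1}&(A_1W_1)^{-2}(A_2+W_1^{-1}W_2A_3)\\0&0\end{bmatrix}:\begin{bmatrix}R((WA)^d)\\N[((WA)^d)^*]\end{bmatrix}\to\begin{bmatrix}R((AW)^d)\\N[((AW)^d)^*]\end{bmatrix},$$ where $A_i,W_i$ ($i=1,2,3$) are the blocks of the canonical block representations of $A$ and $W$.
   Context: $\mathcal{B}(X,Y)$ is the set of bounded linear operators from $X$ to $Y$, $\mathcal{B}(X)=\mathcal{B}(X,X)$; $R(\cdot)$, $N(\cdot)$, $(\cdot)^*$ denote range, null space and adjoint; $P_L$ is the orthogonal projector onto a closed subspace $L$. An operator $T\in\mathcal{B}(X)$ is generalized Drazin invertible if there is a (necessarily unique) $T^d\in\mathcal{B}(X)$ with $TT^d=T^dT$, $T^dTT^d=T^d$ and $T-T^2T^d$ quasinilpotent (and similarly on $Y$). For $W\in\mathcal{B}(Y,X)\setminus\{0\}$, an operator $A\in\mathcal{B}(X,Y)$ is $W$g-Drazin invertible if there is a (necessarily unique) $A^{d,W}=B\in\mathcal{B}(X,Y)$ with $AWB=BWA$, $BWAWB=B$ and $A-AWBWA$ quasinilpotent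 in the weighted sense, i.e. $(A-AWBWA)W$ is a quasinilpotent operator on $Y$. In that case $AW$ and $WA$ are generalized Drazin invertible with $(AW)^d=A^{d,W}W$ and $(WA)^d=WA^{d,W}$. If $A$ is $W$g-Drazin invertible, its weighted core-EP inverse $A^{\mathrm{cEP},W}$ is the unique (it exists) operator $B\in\mathcal{B}(X,Y)$ with $WAWB=P_{R((WA)^d)}$ and $R(B)\subseteq R((AW)^d)$. Canonical block representations: with respect to the orthogonal decompositions $X=R((WA)^d)\oplus N[((WA)^d)^*]$ and $Y=R((AW)^d)\oplus N[((AW)^d)^*]$ one has (known fact) $$A=\begin{bmatrix}A_1&A_2\\0&A_3\end{bmatrix}:X\to Y,\qquad W=\begin{bmatrix}W_1&W_2\\0&W_3\end{bmatrix}:Y\to X,$$ where $A_1$ and $W_1$ are invertible and $A_3W_3$, $W_3A_3$ are quasinilpotent. *)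

theory Defs
  imports "HOL-Analysis.Analysis"
begin

text \<open>Complex Hilbert spaces. The inner product is linear in its first argument.\<close>

class complex_vector = real_vector +
  fixes scaleC :: "complex \<Rightarrow> 'a \<Rightarrow> 'a"  (infixr \<open>*\<^sub>C\<close> 75)
  assumes scaleC_add_right: "c *\<^sub>C (x + y) = c *\<^sub>C x + c *\<^sub>C y"
    and scaleC_add_left: "(c + d) *\<^sub>C x = c *\<^sub>C x + d *\<^sub>C x"
    and scaleC_scaleC: "c *\<^sub>C d *\<^sub>C x = (c * d) *\<^sub>C x"
    and scaleC_one: "1 *\<^sub>C x = x"
    and scaleR_scaleC: "r *\<^sub>R x = complex_of_real r *\<^sub>C x"

global_interpretation complex_vector:
  vector_space "scaleC :: complex \<Rightarrow> 'a \<Rightarrow> 'a::complex_vector"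
  by standard (simp_all add: scaleC_add_right scaleC_add_left scaleC_scaleC scaleC_one)

class complex_inner = complex_vector + real_normed_vector +
  fixes cinner :: "'a \<Rightarrow> 'a \<Rightarrow> complex"
  assumes cinner_commute: "cinner x y = cnj (cinner y x)"
    and cinner_add_left: "cinner (x + y) z = cinner x z + cinner y z"
    and cinner_scaleC_left: "cinner (c *\<^sub>C x) y = c * cinner x y"
    and cinner_self: "cinner x x = complex_of_real ((norm x)\<^sup>2)"

class complex_hilbert_space = complex_inner + banach

instantiation complex :: complex_hilbert_space
begin

definition scaleC_complex :: "complex \<Rightarrow> complex \<Rightarrow> complex"
  where "scaleC_complex c x = c * x"

definition cinner_complex :: "complex \<Rightarrow> complex \<Rightarrow> complex"
  where "cinner_complex x y = x * cnj y"

instance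
proof
  fix x y z c d :: complex and r :: real
  show "c *\<^sub>C (x + y) = c *\<^sub>C x + c *\<^sub>C y"
    and "(c + d) *\<^sub>C x = c *\<^sub>C x + d *\<^sub>C x"
    and "c *\<^sub>C d *\<^sub>C x = (c * d) *\<^sub>C x"
    and "1 *\<^sub>C x = x"
    by (simp_all add: scaleC_complex_def ring_distribs mult.assoc)
  show "r *\<^sub>R x = complex_of_real r *\<^sub>C x"
    by (simp add: scaleC_complex_def scaleR_conv_of_real)
  show "cinner x y = cnj (cinner y x)"
    by (simp add: cinner_complex_def mult.commute)
  show "cinner (x + y) z = cinner x z + cinner y z"
    by (simp add: cinner_complex_def ring_distribs)
  show "cinner (c *\<^sub>C x) y = c * cinner x y"
    by (simp add: cinner_complex_def scaleC_complex_def mult.assoc)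
  show "cinner x x = complex_of_real ((norm x)\<^sup>2)"
    unfolding cinner_complex_def by (rule complex_norm_square[symmetric])
qed

end

definition infinite_dimensional :: "'a::complex_vector itself \<Rightarrow> bool"
  where "infinite_dimensional _ \<longleftrightarrow>
    \<not> (\<exists>S::'a set. finite S \<and> complex_vector.span S = UNIV)"


text \<open>The operators in \<open>B(X,Y)\<close> are the functions satisfying \<open>bounded_clinear\<close>.\<close>

definition bounded_clinear :: "('x::complex_inner \<Rightarrow> 'y::complex_inner) \<Rightarrow> bool"
  where "bounded_clinear T \<longleftrightarrow> bounded_linear T \<and> (\<forall>c x. T (c *\<^sub>C x) = c *\<^sub>C T x)"

definition null_space :: "('x \<Rightarrow> 'y::zero) \<Rightarrow> 'x set"
  where "null_space T = {x. T x = 0}"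

definition cadjoint :: "('x::complex_inner \<Rightarrow> 'y::complex_inner) \<Rightarrow> 'y \<Rightarrow> 'x"
  where "cadjoint T = (THE S. \<forall>x y. cinner (T x) y = cinner x (S y))"

definition orth_proj :: "'x::complex_inner set \<Rightarrow> 'x \<Rightarrow> 'x"
  where "orth_proj L x = (THE y. y \<in> L \<and> (\<forall>z\<in>L. cinner (x - y) z = 0))"

definition op_spectrum :: "('x::complex_inner \<Rightarrow> 'x) \<Rightarrow> complex set"
  where "op_spectrum T = {c. \<not> (\<exists>S. bounded_clinear S \<and>
    (\<forall>x. S (c *\<^sub>C x - T x) = x) \<and> (\<forall>x. c *\<^sub>C S x - T (S x) = x))}"

definition quasinilpotent :: "('x::complex_inner \<Rightarrow> 'x) \<Rightarrow> bool"
  where "quasinilpotent T \<longleftrightarrow> op_spectrum T = {0}"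


definition is_gdrazin_inverse :: "('x::complex_inner \<Rightarrow> 'x) \<Rightarrow> ('x \<Rightarrow> 'x) \<Rightarrow> bool"
  where "is_gdrazin_inverse T S \<longleftrightarrow> bounded_clinear S \<and>
    T \<circ> S = S \<circ> T \<and> S \<circ> T \<circ> S = S \<and> quasinilpotent (\<lambda>x. T x - (T \<circ> T \<circ> S) x)"

definition gdrazin :: "('x::complex_inner \<Rightarrow> 'x) \<Rightarrow> 'x \<Rightarrow> 'x"
  where "gdrazin T = (THE S. is_gdrazin_inverse T S)"

definition is_wgdrazin_inverse ::
    "('y::complex_inner \<Rightarrow> 'x::complex_inner) \<Rightarrow> ('x \<Rightarrow> 'y) \<Rightarrow> ('x \<Rightarrow> 'y) \<Rightarrow> bool"
  where "is_wgdrazin_inverse W A B \<longleftrightarrow> bounded_clinear B \<and>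
    A \<circ> W \<circ> B = B \<circ> W \<circ> A \<and> B \<circ> W \<circ> A \<circ> W \<circ> B = B \<and>
    quasinilpotent ((\<lambda>x. A x - (A \<circ> W \<circ> B \<circ> W \<circ> A) x) \<circ> W)"

definition wgdrazin_invertible ::
    "('y::complex_inner \<Rightarrow> 'x::complex_inner) \<Rightarrow> ('x \<Rightarrow> 'y) \<Rightarrow> bool"
  where "wgdrazin_invertible W A \<longleftrightarrow> (\<exists>B. is_wgdrazin_inverse W A B)"

definition weighted_core_EP ::
    "('y::complex_inner \<Rightarrow> 'x::complex_inner) \<Rightarrow> ('x \<Rightarrow> 'y) \<Rightarrow> 'x \<Rightarrow> 'y"
  where "weighted_core_EP W A = (THE B. bounded_clinear B \<and>
    W \<circ> A \<circ> W \<circ> B = orth_proj (range (gdrazin (W \<circ> A))) \<and>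
    range B \<subseteq> range (gdrazin (A \<circ> W)))"


text \<open>
  For an orthogonal decomposition \<open>K \<oplus> K'\<close> of the codomain, the block of \<open>T\<close> that maps a
  summand \<open>L\<close> of the domain to \<open>K\<close> is the compression \<open>P_K T|L\<close>. Conversely,
  \<open>block_operator L L' T11 T12 T21 T22\<close> is the operator with block matrix
  \<open>[T11, T12; T21, T22]\<close> whose columns refer to the decomposition \<open>L \<oplus> L'\<close> of the domain.
  The decomposition of the codomain need not be supplied, because the blocks are functions into
  the codomain itself, with values in the respective summands.
\<close>

definition block :: "('x \<Rightarrow> 'y::complex_inner) \<Rightarrow> 'x set \<Rightarrow> 'y set \<Rightarrow> 'x \<Rightarrow> 'y"
  where "block T L K = restrict (\<lambda>x. orth_proj K (T x)) L"

definition block_operator ::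
    "'x::complex_inner set \<Rightarrow> 'x set \<Rightarrow> ('x \<Rightarrow> 'y) \<Rightarrow> ('x \<Rightarrow> 'y) \<Rightarrow> ('x \<Rightarrow> 'y) \<Rightarrow> ('x \<Rightarrow> 'y)
      \<Rightarrow> 'x \<Rightarrow> 'y::complex_inner"
  where "block_operator L L' T11 T12 T21 T22 x =
    (T11 (orth_proj L x) + T12 (orth_proj L' x)) + (T21 (orth_proj L x) + T22 (orth_proj L' x))"

end

theory Submission
  imports Defs "HOL-Complex_Analysis.Complex_Analysis"
begin

text \<open>
  Write \<open>D\<close> for the weighted generalized Drazin inverse \<open>A\<^sup>d\<^sup>,\<^sup>W\<close>, \<open>M = R(W D)\<close>,
  \<open>N = R(D W)\<close> and \<open>P\<close> for the orthogonal projector onto \<open>M\<close>. The operators \<open>A\<close> and \<open>W\<close>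
  exchange \<open>M\<close> and \<open>N\<close> bijectively, \<open>W A W D\<close> is a projector onto \<open>M\<close> and \<open>D W A W\<close> one onto \<open>N\<close>;
  hence the weighted core-EP inverse is \<open>E = D P\<close>. Substituting the second equation twice
  into the first gives \<open>B = E W A W B = E W E W A\<close>, and this solves the system because
  \<open>A W E W E = E\<close>. Identifying \<open>(W A)\<^sup>d = W D\<close> needs the uniqueness of generalized Drazin inverses,
  which rests on the decay of the powers of a quasinilpotent operator.
\<close>

section \<open>Complex Hilbert spaces\<close>

lemma cinner_add_right: "cinner x (y + z) = cinner x y + cinner x z"
  by (metis cinner_add_left cinner_commute complex_cnj_add)

lemma cinner_scaleC_right: "cinner x (c *\<^sub>C y) = cnj c * cinner x y"
  by (metis cinner_scaleC_left cinner_commute complex_cnj_mult)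

lemma cinner_zero_left [simp]: "cinner 0 y = 0"
  using cinner_add_left[of 0 0 y] by simp

lemma cinner_zero_right [simp]: "cinner x 0 = 0"
  using cinner_add_right[of x 0 0] by simp

lemma cinner_diff_left: "cinner (x - y) z = cinner x z - cinner y z"
  using cinner_add_left[of "x - y" y z] by simp

lemma cinner_diff_right: "cinner x (y - z) = cinner x y - cinner x z"
  using cinner_add_right[of x "y - z" z] by simp

lemma norm_scaleC: "norm (c *\<^sub>C x) = cmod c * norm (x :: 'a::complex_inner)"
proof -
  have "complex_of_real ((norm (c *\<^sub>C x))\<^sup>2) = complex_of_real ((cmod c * norm x)\<^sup>2)"
    unfolding cinner_self[symmetric] cinner_scaleC_left cinner_scaleC_right
    by (simp add: cinner_self power_mult_distrib complex_norm_square[of c] del: of_real_power)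
  then have "(norm (c *\<^sub>C x))\<^sup>2 = (cmod c * norm x)\<^sup>2"
    using of_real_eq_iff by blast
  then show ?thesis by simp
qed

lemma norm_diff_scaleC_square:
  "complex_of_real ((norm (x - c *\<^sub>C y))\<^sup>2) =
    complex_of_real ((norm x)\<^sup>2) - cnj c * cinner x y - c * cnj (cinner x y)
      + c * cnj c * complex_of_real ((norm y)\<^sup>2)"
  unfolding cinner_self[symmetric]
  by (simp add: cinner_diff_left cinner_diff_right cinner_scaleC_left cinner_scaleC_right
      cinner_commute[of y x] algebra_simps)

text \<open>Pythagoras: the coefficient is that of the orthogonal projection of \<open>x\<close>
  onto the line of \<open>y\<close>. Both Cauchy-Schwarz and the orthogonality of minimizers
  follow.\<close>

lemma norm_diff_component_square:
  assumes "y \<noteq> 0"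
  shows "(norm (x - (cinner x y / complex_of_real ((norm y)\<^sup>2)) *\<^sub>C y))\<^sup>2 =
    (norm x)\<^sup>2 - (cmod (cinner x y))\<^sup>2 / (norm y)\<^sup>2"
proof -
  define s where "s = complex_of_real ((norm y)\<^sup>2)"
  have s: "s \<noteq> 0" "cnj s = s" using assms by (simp_all add: s_def)
  have "complex_of_real ((norm (x - (cinner x y / s) *\<^sub>C y))\<^sup>2) =
     complex_of_real ((norm x)\<^sup>2) - cinner x y * cnj (cinner x y) / s"
    unfolding norm_diff_scaleC_square s_def[symmetric] using s by (simp add: field_simps)
  also have "\<dots> = complex_of_real ((norm x)\<^sup>2 - (cmod (cinner x y))\<^sup>2 / (norm y)\<^sup>2)"
    unfolding s_def complex_norm_square[symmetric] by simp
  finally show ?thesis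
    unfolding s_def using of_real_eq_iff by blast
qed

lemma Cauchy_Schwarz: "cmod (cinner x y) \<le> norm x * norm y"
proof (cases "y = 0")
  case False
  have "(cmod (cinner x y))\<^sup>2 / (norm y)\<^sup>2 \<le> (norm x)\<^sup>2"
    using norm_diff_component_square[OF False, of x]
      zero_le_power2[of "norm (x - (cinner x y / complex_of_real ((norm y)\<^sup>2)) *\<^sub>C y)"] by linarith
  then have "(cmod (cinner x y))\<^sup>2 \<le> (norm x * norm y)\<^sup>2"
    using False by (simp add: field_simps power_mult_distrib)
  then show ?thesis
    by (rule power2_le_imp_le) simp
qed simp

text \<open>Otherwise removing the component of \<open>x\<close> along \<open>y\<close> would
  strictly shorten \<open>x\<close>.\<close>

lemma norm_minimal_imp_orthogonal:
  assumes "\<And>c. norm x \<le> norm (x - c *\<^sub>C y)"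
  shows "cinner x y = 0"
proof (cases "y = 0")
  case False
  have "(norm x)\<^sup>2 \<le> (norm x)\<^sup>2 - (cmod (cinner x y))\<^sup>2 / (norm y)\<^sup>2"
    using assms unfolding norm_diff_component_square[OF False, symmetric]
    by (intro power_mono) auto
  then have "(cmod (cinner x y))\<^sup>2 / (norm y)\<^sup>2 \<le> 0" by simp
  then show ?thesis
    using False by (simp add: divide_le_0_iff)
qed simp

section \<open>Orthogonal projectors onto closed subspaces\<close>

lemma parallelogram:
  "(norm (x + y))\<^sup>2 + (norm (x - y))\<^sup>2 = 2 * (norm x)\<^sup>2 + 2 * (norm (y :: 'a::complex_inner))\<^sup>2"
proof -
  have "complex_of_real ((norm (x + y))\<^sup>2 + (norm (x - y))\<^sup>2) =
      complex_of_real (2 * (norm x)\<^sup>2 + 2 * (norm y)\<^sup>2)"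
    unfolding of_real_add of_real_mult cinner_self[symmetric]
    by (simp add: cinner_add_left cinner_add_right cinner_diff_left cinner_diff_right)
  then show ?thesis
    using of_real_eq_iff by blast
qed

lemma cinner_self_eq_0: "cinner x x = 0 \<Longrightarrow> x = 0"
  by (simp add: cinner_self)

text \<open>A sequence in \<open>L\<close> minimizing the distance to \<open>x\<close> is Cauchy by
  the parallelogram law. Its limit lies in \<open>L\<close> and attains the distance, so the
  difference is orthogonal to \<open>L\<close> by
  \<open>norm_minimal_imp_orthogonal\<close>.\<close>

lemma orth_proj_exists:
  fixes x :: "'a::complex_hilbert_space"
  assumes L: "complex_vector.subspace L" "closed L"
  shows "\<exists>y\<in>L. \<forall>z\<in>L. cinner (x - y) z = 0"
proof -
  define d where "d = infdist x L"
  have ne: "L \<noteq> {}" using complex_vector.subspace_0[OF L(1)] by auto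
  have d0: "d \<ge> 0" unfolding d_def by (rule infdist_nonneg)
  have dle: "d \<le> norm (x - z)" if "z \<in> L" for z
    using infdist_le[OF that, of x] by (simp add: d_def dist_norm)
  have "\<exists>y\<in>L. norm (x - y) < d + 1 / Suc n" for n
  proof -
    have "d < d + 1 / Suc n" by simp
    then have "infdist x L < d + 1 / Suc n" by (simp add: d_def)
    then obtain y where "y \<in> L" "dist x y < d + 1 / Suc n"
      unfolding infdist_notempty[OF ne] using cINF_less_iff[OF ne, of "dist x"] by fastforce
    then show ?thesis by (auto simp: dist_norm)
  qed
  then obtain Y where YL: "\<And>n. Y n \<in> L" and Yd: "\<And>n. norm (x - Y n) < d + 1 / Suc n"
    by metis
  \<comment> \<open>The midpoint of \<open>Y m\<close> and \<open>Y n\<close> lies in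
    \<open>L\<close>, so its distance to \<open>x\<close> is at least \<open>d\<close>; the
    parallelogram law turns this into a bound on \<open>Y m - Y n\<close>.\<close>
  have mid: "(norm (Y m - Y n))\<^sup>2 \<le> 2 * (norm (x - Y m))\<^sup>2 + 2 * (norm (x - Y n))\<^sup>2 - 4 * d\<^sup>2" for m n
  proof -
    have "(1/2) *\<^sub>C (Y m + Y n) \<in> L"
      using L(1) YL by (auto intro!: complex_vector.subspace_scale complex_vector.subspace_add)
    then have *: "d \<le> norm (x - (1/2) *\<^sub>C (Y m + Y n))" by (rule dle)
    have "(x - Y m) + (x - Y n) = 2 *\<^sub>C (x - (1/2) *\<^sub>C (Y m + Y n))"
      using scaleC_add_left[of 1 1 x]
      by (simp add: complex_vector.scale_right_diff_distrib scaleC_scaleC scaleC_one)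
    then have "norm ((x - Y m) + (x - Y n)) = 2 * norm (x - (1/2) *\<^sub>C (Y m + Y n))"
      by (simp only: norm_scaleC) simp
    then have "2 * d \<le> norm ((x - Y m) + (x - Y n))" using * by simp
    then have "(2 * d)\<^sup>2 \<le> (norm ((x - Y m) + (x - Y n)))\<^sup>2"
      using d0 by (intro power_mono) auto
    moreover have "norm ((x - Y m) - (x - Y n)) = norm (Y m - Y n)"
      by (simp add: norm_minus_commute)
    ultimately show ?thesis
      using parallelogram[of "x - Y m" "x - Y n"] by (simp add: power_mult_distrib)
  qed
  have lim: "(\<lambda>n. norm (x - Y n)) \<longlonglongrightarrow> d"
  proof (rule real_tendsto_sandwich)
    show "\<forall>\<^sub>F n in sequentially. d \<le> norm (x - Y n)"
      by (intro always_eventually allI dle YL)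
    show "\<forall>\<^sub>F n in sequentially. norm (x - Y n) \<le> d + 1 / Suc n"
      by (intro always_eventually allI less_imp_le Yd)
    show "(\<lambda>n. d + 1 / Suc n) \<longlonglongrightarrow> d"
      by real_asymp
  qed (rule tendsto_const)
  have "Cauchy Y"
  proof (rule metric_CauchyI)
    fix e :: real assume e: "e > 0"
    have "(\<lambda>n. (norm (x - Y n))\<^sup>2) \<longlonglongrightarrow> d\<^sup>2" by (intro tendsto_intros lim)
    \<comment> \<open>With this tolerance for both indices, \<open>mid\<close> leaves exactly
      \<open>4 * (e\<^sup>2 / 4) = e\<^sup>2\<close>.\<close>
    moreover have "d\<^sup>2 < d\<^sup>2 + e\<^sup>2 / 4" using e by simp
    ultimately have "\<forall>\<^sub>F n in sequentially. (norm (x - Y n))\<^sup>2 < d\<^sup>2 + e\<^sup>2 / 4"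
      by (rule order_tendstoD)
    then obtain k where k: "\<And>n. n \<ge> k \<Longrightarrow> (norm (x - Y n))\<^sup>2 < d\<^sup>2 + e\<^sup>2 / 4"
      by (auto simp: eventually_sequentially)
    have "dist (Y m) (Y n) < e" if "m \<ge> k" "n \<ge> k" for m n
    proof (rule power_less_imp_less_base[of _ 2])
      show "(dist (Y m) (Y n))\<^sup>2 < e\<^sup>2"
        using k[OF that(1)] k[OF that(2)] mid[of m n] unfolding dist_norm by linarith
    qed (use e in simp)
    then show "\<exists>k. \<forall>m\<ge>k. \<forall>n\<ge>k. dist (Y m) (Y n) < e" by blast
  qed
  then obtain y where y: "Y \<longlonglongrightarrow> y"
    using Cauchy_convergent_iff convergent_def by blast
  have yL: "y \<in> L" using L(2) YL y closed_sequentially by blast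
  have "(\<lambda>n. norm (x - Y n)) \<longlonglongrightarrow> norm (x - y)" by (intro tendsto_intros y)
  then have ny: "norm (x - y) = d" using lim LIMSEQ_unique by blast
  have "cinner (x - y) z = 0" if "z \<in> L" for z
  proof (rule norm_minimal_imp_orthogonal)
    fix c
    have "y + c *\<^sub>C z \<in> L"
      using L(1) yL that by (auto intro!: complex_vector.subspace_scale complex_vector.subspace_add)
    from dle[OF this] show "norm (x - y) \<le> norm (x - y - c *\<^sub>C z)"
      by (simp add: ny diff_diff_eq)
  qed
  then show ?thesis using yL by blast
qed

text \<open>Two candidates differ by a vector that is in \<open>L\<close> and orthogonal to
  \<open>L\<close>, hence zero. Identities for \<open>orth_proj\<close> are derived from this
  characterization.\<close>

lemma orth_proj_eqI:
  assumes L: "complex_vector.subspace L" and y: "y \<in> L" "\<And>z. z \<in> L \<Longrightarrow> cinner (x - y) z = 0"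
  shows "orth_proj L x = y"
  unfolding orth_proj_def
proof (rule the_equality)
  fix w assume w: "w \<in> L \<and> (\<forall>z\<in>L. cinner (x - w) z = 0)"
  have "y - w \<in> L" using L w y(1) by (simp add: complex_vector.subspace_diff)
  then have "cinner (x - w) (y - w) - cinner (x - y) (y - w) = 0"
    using w y(2) by simp
  then have "cinner (y - w) (y - w) = 0"
    by (simp add: cinner_diff_left[symmetric])
  then show "w = y" using cinner_self_eq_0 by fastforce
qed (use y in auto)

context
  fixes L :: "'a::complex_hilbert_space set"
  assumes L: "complex_vector.subspace L" "closed L"
begin

lemma orth_proj_in: "orth_proj L x \<in> L"
  and orth_proj_orthogonal: "z \<in> L \<Longrightarrow> cinner (x - orth_proj L x) z = 0"
proof -
  obtain y where "y \<in> L" "\<And>z. z \<in> L \<Longrightarrow> cinner (x - y) z = 0"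
    using orth_proj_exists[OF L] by blast
  moreover from this have "orth_proj L x = y" by (rule orth_proj_eqI[OF L(1)])
  ultimately show "orth_proj L x \<in> L" "z \<in> L \<Longrightarrow> cinner (x - orth_proj L x) z = 0" by auto
qed

lemma orth_proj_fixed: "x \<in> L \<Longrightarrow> orth_proj L x = x"
  by (rule orth_proj_eqI[OF L(1)]) auto

lemma orth_proj_add: "orth_proj L (x + y) = orth_proj L x + orth_proj L y"
proof (rule orth_proj_eqI[OF L(1)])
  show "orth_proj L x + orth_proj L y \<in> L"
    by (intro complex_vector.subspace_add L(1) orth_proj_in)
  fix z assume "z \<in> L"
  then show "cinner (x + y - (orth_proj L x + orth_proj L y)) z = 0"
    using orth_proj_orthogonal[of z x] orth_proj_orthogonal[of z y]
    by (simp add: cinner_diff_left cinner_add_left)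
qed

lemma orth_proj_scaleC: "orth_proj L (c *\<^sub>C x) = c *\<^sub>C orth_proj L x"
proof (rule orth_proj_eqI[OF L(1)])
  show "c *\<^sub>C orth_proj L x \<in> L"
    by (intro complex_vector.subspace_scale L(1) orth_proj_in)
  fix z assume "z \<in> L"
  then show "cinner (c *\<^sub>C x - c *\<^sub>C orth_proj L x) z = 0"
    using orth_proj_orthogonal[of z x]
    by (simp add: complex_vector.scale_right_diff_distrib[symmetric] cinner_scaleC_left)
qed

lemma norm_orth_proj_le: "norm (orth_proj L x) \<le> norm x"
proof (cases "orth_proj L x = 0")
  case False
  have "complex_of_real ((norm (orth_proj L x))\<^sup>2) = cinner x (orth_proj L x)"
    using orth_proj_orthogonal[OF orth_proj_in, of x x]
    by (simp add: cinner_diff_left cinner_self)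
  then have "(norm (orth_proj L x))\<^sup>2 = cmod (cinner x (orth_proj L x))"
    by (metis norm_of_real abs_of_nonneg zero_le_power2)
  also have "\<dots> \<le> norm x * norm (orth_proj L x)" by (rule Cauchy_Schwarz)
  finally show ?thesis using False by (simp add: power2_eq_square)
qed simp

lemma bounded_clinear_orth_proj: "bounded_clinear (orth_proj L)"
  unfolding bounded_clinear_def
proof (intro conjI allI bounded_linear_intro[where K = 1])
qed (auto simp: orth_proj_add orth_proj_scaleC scaleR_scaleC norm_orth_proj_le)

end

section \<open>Bounded operators and their adjoints\<close>

lemma bounded_clinear_add: "bounded_clinear T \<Longrightarrow> T (x + y) = T x + T y"
  and bounded_clinear_diff: "bounded_clinear T \<Longrightarrow> T (x - y) = T x - T y"
  and bounded_clinear_scaleC: "bounded_clinear T \<Longrightarrow> T (c *\<^sub>C x) = c *\<^sub>C T x"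
  and bounded_clinear_zero: "bounded_clinear T \<Longrightarrow> T 0 = 0"
  unfolding bounded_clinear_def
  by (auto simp: linear_simps bounded_linear.linear intro: linear_0)

lemma bounded_clinear_bound:
  assumes "bounded_clinear T"
  obtains K where "K > 0" "\<And>x. norm (T x) \<le> K * norm x"
  using assms bounded_linear.pos_bounded[of T] unfolding bounded_clinear_def
  by (metis mult.commute)

lemma bounded_clinearI:
  assumes "\<And>x y. T (x + y) = T x + T y" "\<And>c x. T (c *\<^sub>C x) = c *\<^sub>C T x"
    "\<And>x. norm (T x) \<le> K * norm x"
  shows "bounded_clinear T"
  unfolding bounded_clinear_def
  using assms by (auto intro!: bounded_linear_intro[where K = K] simp: scaleR_scaleC mult.commute)

lemma bounded_clinear_compose:
  "bounded_clinear S \<Longrightarrow> bounded_clinear T \<Longrightarrow> bounded_clinear (S \<circ> T)"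
  unfolding bounded_clinear_def by (auto intro: bounded_linear_compose simp: o_def)

lemma bounded_clinear_zero_fun: "bounded_clinear (\<lambda>x. 0)"
  by (rule bounded_clinearI[where K = 0]) auto

lemma bounded_clinear_minus_fun:
  "bounded_clinear S \<Longrightarrow> bounded_clinear T \<Longrightarrow> bounded_clinear (\<lambda>x. S x - T x)"
  unfolding bounded_clinear_def
  by (auto intro: bounded_linear_sub simp: complex_vector.scale_right_diff_distrib)

text \<open>For \<open>f\<close> not zero, a vector \<open>u\<close> orthogonal to the kernel is
  obtained by projecting. Every \<open>x\<close> differs from a multiple of \<open>u\<close> by a
  kernel vector, so pairing with \<open>u\<close> recovers \<open>f x\<close>. The conjugate in the
  scalar compensates for conjugate linearity in the second argument.\<close>

lemma Riesz_representation:
  fixes f :: "'a::complex_hilbert_space \<Rightarrow> complex"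
  assumes f: "bounded_clinear f"
  shows "\<exists>v. \<forall>x. f x = cinner x v"
proof (cases "\<forall>x. f x = 0")
  case False
  then obtain x0 where x0: "f x0 \<noteq> 0" by blast
  define L where "L = {x. f x = 0}"
  have sub: "complex_vector.subspace L"
    unfolding L_def using f
    by (auto intro!: complex_vector.subspaceI
        simp: bounded_clinear_add bounded_clinear_scaleC bounded_clinear_zero scaleC_complex_def)
  have "closed L" unfolding L_def
    using f unfolding bounded_clinear_def
    by (intro closed_Collect_eq continuous_on_const linear_continuous_on) auto
  note L = sub this
  define u where "u = x0 - orth_proj L x0"
  have fu: "f u \<noteq> 0"
    using x0 orth_proj_in[OF L, of x0] f by (simp add: u_def bounded_clinear_diff L_def)
  then have u0: "u \<noteq> 0" using f bounded_clinear_zero by metis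
  have "f x = cinner x ((cnj (f u) / complex_of_real ((norm u)\<^sup>2)) *\<^sub>C u)" for x
  proof -
    have "x - (f x / f u) *\<^sub>C u \<in> L"
      using f fu by (simp add: L_def bounded_clinear_diff bounded_clinear_scaleC scaleC_complex_def)
    then have "cinner u (x - (f x / f u) *\<^sub>C u) = 0"
      unfolding u_def by (rule orth_proj_orthogonal[OF L])
    then have "cinner (x - (f x / f u) *\<^sub>C u) u = 0"
      using cinner_commute by (metis complex_cnj_zero)
    then have "cinner x u = (f x / f u) * complex_of_real ((norm u)\<^sup>2)"
      by (simp add: cinner_diff_left cinner_scaleC_left cinner_self)
    then show ?thesis using fu u0 by (simp add: cinner_scaleC_right)
  qed
  then show ?thesis by blast
qed (auto intro: exI[of _ 0])

text \<open>Justifies the definite description in \<open>cadjoint\<close>: Riesz, applied for each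
  \<open>y\<close>, gives existence, and testing two candidates against their difference gives
  uniqueness.\<close>

lemma cinner_cadjoint:
  fixes T :: "'a::complex_hilbert_space \<Rightarrow> 'b::complex_inner"
  assumes T: "bounded_clinear T"
  shows "cinner (T x) y = cinner x (cadjoint T y)"
proof -
  obtain K where K: "\<And>x. norm (T x) \<le> K * norm x"
    using bounded_clinear_bound[OF T] by blast
  have "bounded_clinear (\<lambda>x. cinner (T x) y)" for y
  proof (rule bounded_clinearI)
    show "norm (cinner (T x) y) \<le> (K * norm y) * norm x" for x
    proof -
      have "norm (cinner (T x) y) \<le> norm (T x) * norm y" by (rule Cauchy_Schwarz)
      also have "\<dots> \<le> (K * norm x) * norm y" by (intro mult_right_mono K) auto
      finally show ?thesis by (simp add: mult_ac)
    qed
  qed (use T in \<open>auto simp: bounded_clinear_add bounded_clinear_scaleC cinner_add_left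
      cinner_scaleC_left scaleC_complex_def\<close>)
  then have "\<exists>v. \<forall>x. cinner (T x) y = cinner x v" for y
    by (rule Riesz_representation)
  then obtain S where S: "\<forall>x y. cinner (T x) y = cinner x (S y)" by metis
  have "cadjoint T = S"
    unfolding cadjoint_def
  proof (rule the_equality)
    show "\<forall>x y. cinner (T x) y = cinner x (S y)" by (rule S)
    fix S' assume S': "\<forall>x y. cinner (T x) y = cinner x (S' y)"
    show "S' = S"
    proof
      fix y
      have "cinner (S' y - S y) (S' y) = cinner (S' y - S y) (S y)"
        using S[rule_format, of "S' y - S y" y] S'[rule_format, of "S' y - S y" y] by simp
      then have "cinner (S' y - S y) (S' y - S y) = 0"
        by (simp add: cinner_diff_right)
      then show "S' y = S y" using cinner_self_eq_0 by fastforce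
    qed
  qed
  then show ?thesis using S by simp
qed

text \<open>Turns the second summands of the decompositions into orthogonal complements of ranges.
  If \<open>y\<close> is orthogonal to the range, testing with \<open>cadjoint T y\<close> gives
  that vector norm zero.\<close>

lemma null_space_cadjoint:
  fixes T :: "'a::complex_hilbert_space \<Rightarrow> 'b::complex_inner"
  assumes "bounded_clinear T"
  shows "null_space (cadjoint T) = {y. \<forall>z\<in>range T. cinner y z = 0}"
proof -
  have "cadjoint T y = 0 \<longleftrightarrow> (\<forall>x. cinner y (T x) = 0)" for y
  proof
    assume "cadjoint T y = 0"
    then have "cinner (T x) y = 0" for x by (simp add: cinner_cadjoint[OF assms])
    then show "\<forall>x. cinner y (T x) = 0" by (metis cinner_commute complex_cnj_zero)
  next
    assume "\<forall>x. cinner y (T x) = 0"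
    then have "cinner (T (cadjoint T y)) y = 0" by (metis cinner_commute complex_cnj_zero)
    then show "cadjoint T y = 0" unfolding cinner_cadjoint[OF assms] by (rule cinner_self_eq_0)
  qed
  then show ?thesis by (auto simp: null_space_def)
qed

lemma orth_proj_complement:
  fixes L :: "'a::complex_hilbert_space set"
  assumes L: "complex_vector.subspace L" "closed L"
  shows "orth_proj {y. \<forall>z\<in>L. cinner y z = 0} x = x - orth_proj L x"
proof (rule orth_proj_eqI)
  show "complex_vector.subspace {y. \<forall>z\<in>L. cinner y z = 0}"
    by (auto intro!: complex_vector.subspaceI simp: cinner_add_left cinner_scaleC_left)
  show "x - orth_proj L x \<in> {y. \<forall>z\<in>L. cinner y z = 0}"
    using orth_proj_orthogonal[OF L] by simp
  fix z assume "z \<in> {y. \<forall>z\<in>L. cinner y z = 0}"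
  then show "cinner (x - (x - orth_proj L x)) z = 0"
    using orth_proj_in[OF L] by simp (metis cinner_commute complex_cnj_zero)
qed

section \<open>Quasinilpotent operators\<close>

text \<open>Passes to the reciprocal spectral parameter: \<open>E c\<close> is the inverse of
  \<open>1 - c Q\<close>, so the family lives on the whole plane, including \<open>c = 0\<close>.
  Assuming an inclusion rather than equality also covers an empty spectrum, as
  \<open>op_spectrum_nonempty\<close> requires.\<close>

lemma resolvent_family_exists:
  assumes Q: "op_spectrum Q \<subseteq> {0}"
  obtains E where "\<And>c. bounded_clinear (E c)"
    "\<And>c x. E c (x - c *\<^sub>C Q x) = x" "\<And>c x. E c x - c *\<^sub>C Q (E c x) = x"
proof -
  have "\<exists>S. bounded_clinear S \<and> (\<forall>x. S (x - c *\<^sub>C Q x) = x) \<and> (\<forall>x. S x - c *\<^sub>C Q (S x) = x)" for c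
  proof (cases "c = 0")
    case True
    have "bounded_clinear (\<lambda>x :: 'a. x)"
      unfolding bounded_clinear_def by simp
    then show ?thesis using True by (intro exI[of _ "\<lambda>x. x"]) simp
  next
    case False
    then have "1 / c \<notin> op_spectrum Q" using Q by auto
    then obtain S where S: "bounded_clinear S" "\<And>x. S ((1 / c) *\<^sub>C x - Q x) = x"
      "\<And>x. (1 / c) *\<^sub>C S x - Q (S x) = x"
      unfolding op_spectrum_def by auto
    define S' where "S' = (\<lambda>x. (1 / c) *\<^sub>C S x)"
    have S'_eq: "S' x = S ((1 / c) *\<^sub>C x)" for x
      by (simp add: S'_def bounded_clinear_scaleC[OF S(1)])
    obtain K where K: "\<And>x. norm (S x) \<le> K * norm x" using bounded_clinear_bound[OF S(1)] by blast
    have "bounded_clinear S'"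
    proof (rule bounded_clinearI)
      show "norm (S' x) \<le> (K * cmod (1 / c)) * norm x" for x
        unfolding S'_eq using K[of "(1 / c) *\<^sub>C x"] by (simp add: norm_scaleC mult_ac)
    qed (simp_all add: S'_def S(1) bounded_clinear_add bounded_clinear_scaleC scaleC_add_right
        scaleC_scaleC mult.commute)
    moreover have "S' (x - c *\<^sub>C Q x) = x" for x
      using S(2)[of x] False unfolding S'_eq
      by (simp add: complex_vector.scale_right_diff_distrib scaleC_scaleC scaleC_one)
    moreover have "S' x - c *\<^sub>C Q (S' x) = x" for x
    proof -
      have "c *\<^sub>C ((1 / c) *\<^sub>C S' x - Q (S' x)) = S' x - c *\<^sub>C Q (S' x)"
        using False by (simp add: complex_vector.scale_right_diff_distrib scaleC_scaleC scaleC_one)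
      moreover have "(1 / c) *\<^sub>C S' x - Q (S' x) = (1 / c) *\<^sub>C x"
        unfolding S'_eq by (rule S(3))
      ultimately show ?thesis using False by (simp add: scaleC_scaleC scaleC_one)
    qed
    ultimately show ?thesis by blast
  qed
  then show ?thesis using that by metis
qed

text \<open>Cauchy's inequality for the entire functions \<open>c \<mapsto> \<langle>(1 - c Q)\<^sup>-\<^sup>1 z, y\<rangle>\<close>,
  whose Taylor coefficients at \<open>0\<close> are \<open>\<langle>Q\<^sup>n z, y\<rangle>\<close>.\<close>

lemma spectrum_zero_growth:
  assumes Q: "bounded_clinear Q" and spec: "op_spectrum Q \<subseteq> {0}" and r: "r > 0"
  shows "\<exists>K. \<forall>n x. norm ((Q ^^ n) x) * r ^ n \<le> K * norm x"
proof -
  obtain E where E: "\<And>c. bounded_clinear (E c)"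
    and E1: "\<And>c x. E c (x - c *\<^sub>C Q x) = x" and E2: "\<And>c x. E c x - c *\<^sub>C Q (E c x) = x"
    using resolvent_family_exists[OF spec] by blast
  obtain q where q: "q > 0" "\<And>x. norm (Q x) \<le> q * norm x" using bounded_clinear_bound[OF Q] by blast
  \<comment> \<open>The resolvent identity, from applying \<open>E a\<close> to
    \<open>x = (1 - a Q) E c x - (c - a) Q E c x\<close>.\<close>
  have resolvent: "E c x = E a x + (c - a) *\<^sub>C E a (Q (E c x))" for a c x
  proof -
    have "x = (E c x - a *\<^sub>C Q (E c x)) - (c - a) *\<^sub>C Q (E c x)"
      using E2[of c x] by (simp add: complex_vector.scale_left_diff_distrib)
    then have "E a x = E a ((E c x - a *\<^sub>C Q (E c x)) - (c - a) *\<^sub>C Q (E c x))"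
      by (rule arg_cong)
    also have "\<dots> = E c x - (c - a) *\<^sub>C E a (Q (E c x))"
      by (simp only: bounded_clinear_diff[OF E, of a "E c x - a *\<^sub>C Q (E c x)"]
          bounded_clinear_scaleC[OF E] E1)
    finally show ?thesis by simp
  qed
  have "\<exists>d k. d > 0 \<and> k > 0 \<and> (\<forall>c x. dist a c < d \<longrightarrow> norm (E c x) \<le> k * norm x)" for a
  proof -
    obtain k where k: "k > 0" "\<And>x. norm (E a x) \<le> k * norm x"
      using bounded_clinear_bound[OF E] by blast
    \<comment> \<open>Within this radius the correction term of the resolvent identity is at most
      half of \<open>norm (E c x)\<close> and can be absorbed on the left; hence the local bound
      \<open>2 * k\<close>.\<close>
    define d where "d = 1 / (2 * q * k)"
    have d: "d > 0" using k q by (simp add: d_def)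
    have "norm (E c x) \<le> (2 * k) * norm x" if "dist a c < d" for c x
    proof -
      have "norm ((c - a) *\<^sub>C E a (Q (E c x))) \<le> d * (k * (q * norm (E c x)))"
        unfolding norm_scaleC
        using that d k q by (intro mult_mono order_trans[OF k(2)])
          (auto simp: dist_norm norm_minus_commute)
      also have "\<dots> = norm (E c x) / 2" using k q by (simp add: d_def)
      finally have "norm (E c x) \<le> norm (E a x) + norm (E c x) / 2"
        using norm_triangle_ineq[of "E a x" "(c - a) *\<^sub>C E a (Q (E c x))"]
        unfolding resolvent[of c x a, symmetric] by linarith
      then show ?thesis using k(2)[of x] by simp
    qed
    then show ?thesis using d k by (intro exI[of _ d] exI[of _ "2 * k"]) simp
  qed
  then obtain d k where d: "\<And>a. d a > 0" and k: "\<And>a. k a > 0"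
    and dk: "\<And>a c x. dist a c < d a \<Longrightarrow> norm (E c x) \<le> k a * norm x"
    by metis
  \<comment> \<open>Compactness of the disc makes the local bounds uniform; as they are positive,
    the sum over a finite cover dominates each of them.\<close>
  obtain C where C: "C \<subseteq> cball 0 r" "finite C" "cball 0 r \<subseteq> (\<Union>a\<in>C. ball a (d a))"
    using compactE_image[of "cball (0::complex) r" "cball 0 r" "\<lambda>a. ball a (d a)"] d by force
  define K where "K = (\<Sum>a\<in>C. k a)"
  have K: "norm (E c x) \<le> K * norm x" if c: "c \<in> cball 0 r" for c x
  proof -
    obtain a where a: "a \<in> C" "dist a c < d a" using C(3) c by auto
    have "k a \<le> K" unfolding K_def using a C(2) less_imp_le[OF k] by (intro member_le_sum) auto
    then show ?thesis using dk[OF a(2), of x] by (meson mult_right_mono norm_ge_zero order_trans)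
  qed
  define f where "f z y c = cinner (E c z) y" for z y c
  \<comment> \<open>Using the resolvent identity twice, the difference quotient minus its limit
    equals \<open>(c - a) * cinner v y\<close>. Here \<open>v\<close> is a product of three
    resolvents and two copies of \<open>Q\<close>, which the local bound near \<open>a\<close>
    controls by \<open>B\<close>.\<close>
  have deriv: "(f z y has_field_derivative cinner (E a (Q (E a z))) y) (at a)" for z y a
    unfolding has_field_derivative_iff
  proof (rule LIM_zero_cancel, rule Lim_null_comparison)
    define B where "B = k a * (q * (k a * (q * (k a * norm z)))) * norm y"
    show "((\<lambda>c. cmod (c - a) * B) \<longlongrightarrow> 0) (at a)"
      by (auto intro!: tendsto_eq_intros)
    have "norm ((f z y c - f z y a) / (c - a) - cinner (E a (Q (E a z))) y) \<le> cmod (c - a) * B"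
      if c: "dist c a < d a" "c \<noteq> a" for c
    proof -
      have bnd: "norm (E a x) \<le> k a * norm x" "norm (E c x) \<le> k a * norm x" for x
        using dk[of a a x] d[of a] dk[of a c x] c by (auto simp: dist_commute)
      define v where "v = E a (Q (E a (Q (E c z))))"
      have diff: "f w y c - f w y a = (c - a) * cinner (E a (Q (E c w))) y" for w
        unfolding f_def using resolvent[of c w a]
        by (metis add_diff_cancel_left' cinner_diff_left cinner_scaleC_left)
      have "Q (E c z) = Q (E a z) + (c - a) *\<^sub>C Q (E a (Q (E c z)))"
        using resolvent[of c z a] Q by (metis bounded_clinear_add bounded_clinear_scaleC)
      then have "E a (Q (E c z)) = E a (Q (E a z)) + (c - a) *\<^sub>C v"
        unfolding v_def using E by (metis bounded_clinear_add bounded_clinear_scaleC)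
      then have "(f z y c - f z y a) / (c - a) - cinner (E a (Q (E a z))) y = (c - a) * cinner v y"
        using diff[of z] c(2) by (simp add: cinner_add_left cinner_scaleC_left)
      moreover have "cmod (cinner v y) \<le> B"
      proof -
        have "norm v \<le> k a * (q * (k a * (q * (k a * norm z))))"
          unfolding v_def using less_imp_le[OF k[of a]] q(1)
          by (intro order_trans[OF bnd(1)] order_trans[OF q(2)] order_trans[OF bnd(2)] mult_left_mono)
            auto
        then show ?thesis
          unfolding B_def by (meson Cauchy_Schwarz mult_right_mono norm_ge_zero order_trans)
      qed
      ultimately show ?thesis by (simp add: norm_mult mult_left_mono)
    qed
    then show "\<forall>\<^sub>F c in at a. norm ((f z y c - f z y a) / (c - a) - cinner (E a (Q (E a z))) y)
        \<le> cmod (c - a) * B"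
      unfolding eventually_at using d[of a] by auto
  qed
  have hol: "f z y holomorphic_on S" for z y S
    unfolding holomorphic_on_def using deriv field_differentiable_at_within field_differentiable_def
    by blast
  \<comment> \<open>The relation \<open>E c z = z + c E c (Q z)\<close> shifts the Taylor series by
    one place, so the induction passes from \<open>z\<close> to \<open>Q z\<close>.\<close>
  have coeff: "fps_nth (fps_expansion (f z y) 0) n = cinner ((Q ^^ n) z) y" for z y n
  proof (induction n arbitrary: z)
    case 0
    have "E 0 z = z" using E2[of 0 z] by simp
    then show ?case by (simp add: fps_expansion_def f_def)
  next
    case (Suc n)
    have exp: "f w y has_fps_expansion fps_expansion (f w y) 0" for w
      by (rule has_fps_expansion_fps_expansion[of UNIV]) (auto intro: hol)
    have "f z y c = cinner z y + c * f (Q z) y c" for c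
    proof -
      have "E c z - E c (c *\<^sub>C Q z) = z"
        using E1[of c z] by (simp only: bounded_clinear_diff[OF E])
      then have "E c z = z + E c (c *\<^sub>C Q z)"
        by (simp only: diff_eq_eq)
      then show ?thesis
        unfolding f_def bounded_clinear_scaleC[OF E]
        by (metis cinner_add_left cinner_scaleC_left)
    qed
    then have "f z y = (\<lambda>c. cinner z y + c * f (Q z) y c)" by blast
    moreover have "(\<lambda>c. cinner z y + c * f (Q z) y c) has_fps_expansion
        fps_const (cinner z y) + fps_X * fps_expansion (f (Q z) y) 0"
      by (intro fps_expansion_intros exp)
    ultimately have "fps_expansion (f z y) 0 =
        fps_const (cinner z y) + fps_X * fps_expansion (f (Q z) y) 0"
      using exp[of z] fps_expansion_unique_complex by metis
    then show ?case using Suc[of "Q z"] by (simp add: funpow_swap1)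
  qed
  have "norm ((Q ^^ n) x) * r ^ n \<le> K * norm x" for n x
  proof (cases "(Q ^^ n) x = 0")
    case True
    then show ?thesis using K[of 0 x] r by simp (metis norm_ge_zero order_trans)
  next
    case False
    \<comment> \<open>With this \<open>y\<close> the coefficient becomes
      \<open>(norm y)\<^sup>2\<close>, and cancelling one factor \<open>norm y\<close> yields the
      norm bound.\<close>
    define y where "y = (Q ^^ n) x"
    have "norm ((deriv ^^ n) (f x y) 0) \<le> fact n * (K * norm x * norm y) / r ^ n"
    proof (rule Cauchy_inequality)
      show "continuous_on (cball 0 r) (f x y)" by (intro holomorphic_on_imp_continuous_on hol)
      fix c :: complex assume "norm (0 - c) = r"
      then show "norm (f x y c) \<le> K * norm x * norm y"
        unfolding f_def by (intro order_trans[OF Cauchy_Schwarz] mult_right_mono K) auto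
    qed (auto intro: hol r)
    moreover have "(deriv ^^ n) (f x y) 0 = fact n * cinner y y"
      using coeff[of x y n] by (simp add: fps_expansion_def y_def field_simps)
    ultimately have "fact n * (norm y)\<^sup>2 \<le> fact n * (K * norm x * norm y / r ^ n)"
      by (simp add: norm_mult cinner_self norm_power)
    then have "(norm y)\<^sup>2 \<le> K * norm x * norm y / r ^ n"
      by (subst (asm) mult_le_cancel_left_pos) auto
    then have "(norm y * r ^ n) * norm y \<le> (K * norm x) * norm y"
      using r by (simp add: field_simps power2_eq_square)
    moreover have "norm y > 0" using False by (simp add: y_def)
    ultimately show ?thesis unfolding y_def by (meson mult_le_cancel_right_pos)
  qed
  then show ?thesis by blast
qed

lemma funpow_growth:
  fixes S :: "'a::real_normed_vector \<Rightarrow> 'a"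
  assumes "\<And>x. norm (S x) \<le> k * norm x" "k \<ge> 0"
  shows "norm ((S ^^ n) x) \<le> k ^ n * norm x"
proof (induction n)
  case (Suc n)
  have "norm (S ((S ^^ n) x)) \<le> k * (k ^ n * norm x)"
    by (rule order_trans[OF assms(1)]) (intro mult_left_mono Suc assms(2))
  then show ?case by (simp add: mult_ac)
qed simp

text \<open>Powers of \<open>Q\<close> decay faster than any geometric sequence while those of
  \<open>S\<close> grow at most geometrically, so the fixed vector \<open>z\<close> is arbitrarily
  small. Only positive \<open>n\<close> enter, since at \<open>n = 0\<close> both alternatives would
  read \<open>z = x\<close>.\<close>

lemma funpow_comp_quasinilpotent_eq_0:
  assumes Q: "bounded_clinear Q" "op_spectrum Q \<subseteq> {0}" and S: "bounded_clinear S"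
    and z: "\<And>n. n > 0 \<Longrightarrow> z = (S ^^ n) ((Q ^^ n) x) \<or> z = (Q ^^ n) ((S ^^ n) x)"
  shows "z = 0"
proof -
  obtain k where k: "k > 0" "\<And>x. norm (S x) \<le> k * norm x" using bounded_clinear_bound[OF S] by blast
  \<comment> \<open>Twice the bound of \<open>S\<close>, so that a factor \<open>(1 / 2) ^ n\<close>
    remains in the product.\<close>
  obtain K where K: "\<And>n x. norm ((Q ^^ n) x) * (2 * k) ^ n \<le> K * norm x"
    using spectrum_zero_growth[OF Q, of "2 * k"] k(1) by auto
  have K': "norm ((Q ^^ n) x) \<le> K * norm x / (2 * k) ^ n" for n x
    using K[of n x] k(1) by (simp add: field_simps)
  have "K * norm x \<ge> 0" using K[of 0 x] by (metis norm_ge_zero order_trans mult.right_neutral power_0)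
  have bound: "norm z \<le> K * norm x * (1 / 2) ^ n" if "n > 0" for n
    using z[OF that]
  proof
    assume "z = (S ^^ n) ((Q ^^ n) x)"
    then have "norm z \<le> k ^ n * norm ((Q ^^ n) x)"
      using funpow_growth[of S k] k by simp
    also have "\<dots> \<le> k ^ n * (K * norm x / (2 * k) ^ n)"
      using k(1) by (intro mult_left_mono K') auto
    also have "\<dots> = K * norm x * (1 / 2) ^ n"
      using k(1) by (simp add: power_mult_distrib field_simps)
    finally show ?thesis .
  next
    assume z: "z = (Q ^^ n) ((S ^^ n) x)"
    have "norm z * (2 * k) ^ n \<le> K * norm ((S ^^ n) x)" unfolding z by (rule K)
    \<comment> \<open>\<open>K\<close> could be negative on the zero space, hence the absolute
      value; \<open>K * norm x \<ge> 0\<close> removes it again.\<close>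
    also have "\<dots> \<le> \<bar>K\<bar> * (k ^ n * norm x)"
      using k by (intro mult_mono funpow_growth) auto
    also have "\<dots> = K * norm x * k ^ n"
      using \<open>K * norm x \<ge> 0\<close> by (cases "norm x = 0") (auto simp: zero_le_mult_iff)
    finally show ?thesis using k(1) by (simp add: power_mult_distrib field_simps)
  qed
  have "(\<lambda>n. K * norm x * (1 / 2) ^ n) \<longlonglongrightarrow> K * norm x * 0"
    by (intro tendsto_intros LIMSEQ_realpow_zero) auto
  then have "norm z \<le> K * norm x * 0"
    using bound by (intro Lim_bounded2[of _ _ 1 "norm z"]) auto
  then show ?thesis by simp
qed

text \<open>Jacobson's formula: if \<open>S\<close> inverts \<open>c - V U\<close>, then
  \<open>(1 / c) (1 + U S V)\<close> inverts \<open>c - U V\<close>.\<close>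

lemma op_spectrum_commute:
  fixes U :: "'b::complex_inner \<Rightarrow> 'a::complex_inner" and V :: "'a \<Rightarrow> 'b"
  assumes U: "bounded_clinear U" and V: "bounded_clinear V"
    and c: "c \<noteq> 0" "c \<in> op_spectrum (U \<circ> V)"
  shows "c \<in> op_spectrum (V \<circ> U)"
proof (rule ccontr)
  assume "c \<notin> op_spectrum (V \<circ> U)"
  then obtain S where S: "bounded_clinear S" "\<And>x. S (c *\<^sub>C x - V (U x)) = x"
    "\<And>x. c *\<^sub>C S x - V (U (S x)) = x"
    unfolding op_spectrum_def by auto
  define R where "R x = (1 / c) *\<^sub>C (x + U (S (V x)))" for x
  note lin = bounded_clinear_add bounded_clinear_diff bounded_clinear_scaleC
  have USV: "bounded_clinear (U \<circ> S \<circ> V)"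
    by (intro bounded_clinear_compose U V S(1))
  obtain K where K: "\<And>x. norm ((U \<circ> S \<circ> V) x) \<le> K * norm x"
    using bounded_clinear_bound[OF USV] by blast
  have "bounded_clinear R"
  proof (rule bounded_clinearI)
    show "norm (R x) \<le> (cmod (1 / c) * (1 + K)) * norm x" for x
    proof -
      have "norm (x + U (S (V x))) \<le> norm x + K * norm x"
        using norm_triangle_ineq[of x "U (S (V x))"] K[of x] by simp
      then have "cmod (1 / c) * norm (x + U (S (V x))) \<le> cmod (1 / c) * (norm x + K * norm x)"
        by (rule mult_left_mono) simp
      then show ?thesis unfolding R_def norm_scaleC by (simp add: algebra_simps)
    qed
    show "R (x + y) = R x + R y" for x y
      unfolding R_def lin(1)[OF V] lin(1)[OF S(1)] lin(1)[OF U] by (simp add: scaleC_add_right)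
    show "R (a *\<^sub>C x) = a *\<^sub>C R x" for a x
      unfolding R_def lin(3)[OF V] lin(3)[OF S(1)] lin(3)[OF U]
      by (simp add: scaleC_add_right scaleC_scaleC mult.commute)
  qed
  moreover have "R (c *\<^sub>C x - (U \<circ> V) x) = x" for x
  proof -
    have "V (c *\<^sub>C x - U (V x)) = c *\<^sub>C V x - V (U (V x))"
      unfolding lin(2)[OF V] lin(3)[OF V] ..
    then have "R (c *\<^sub>C x - (U \<circ> V) x) = (1 / c) *\<^sub>C (c *\<^sub>C x)"
      by (simp add: R_def S(2))
    then show ?thesis using c(1) by (simp add: scaleC_scaleC scaleC_one)
  qed
  moreover have "c *\<^sub>C R x - (U \<circ> V) (R x) = x" for x
  proof -
    define w where "w = S (V x)"
    have "V (U w) = c *\<^sub>C w - V x" using S(3)[of "V x"] by (simp add: w_def algebra_simps)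
    then have "U (V (U w)) = c *\<^sub>C U w - U (V x)"
      by (simp only: lin(2)[OF U] lin(3)[OF U])
    then have "U (V (x + U w)) = c *\<^sub>C U w"
      by (simp only: lin(1)[OF U] lin(1)[OF V]) simp
    then have "U (V (R x)) = U w"
      unfolding R_def w_def[symmetric] lin(3)[OF V] lin(3)[OF U]
      using c(1) by (simp add: scaleC_scaleC scaleC_one)
    moreover have "c *\<^sub>C R x = x + U w"
      unfolding R_def w_def[symmetric] using c(1) by (simp add: scaleC_scaleC scaleC_one)
    ultimately show ?thesis by simp
  qed
  ultimately show False using c(2) unfolding op_spectrum_def by blast
qed

text \<open>With empty spectrum, \<open>T\<close> has a bounded left inverse \<open>R\<close>, the
  negative of the resolvent at \<open>0\<close>. Then \<open>R\<^sup>n T\<^sup>n x = x\<close> for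
  all \<open>n\<close>, which the decay of the powers of \<open>T\<close> allows only for
  \<open>x = 0\<close>.\<close>

lemma op_spectrum_nonempty:
  fixes T :: "'a::complex_inner \<Rightarrow> 'a"
  assumes T: "bounded_clinear T" and nontrivial: "\<exists>x :: 'a. x \<noteq> 0"
  shows "op_spectrum T \<noteq> {}"
proof
  assume empty: "op_spectrum T = {}"
  then have "0 \<notin> op_spectrum T" by simp
  then have "\<exists>S. bounded_clinear S \<and> (\<forall>x. S (0 *\<^sub>C x - T x) = x) \<and> (\<forall>x. 0 *\<^sub>C S x - T (S x) = x)"
    by (simp only: op_spectrum_def mem_Collect_eq not_not)
  then obtain S where S: "bounded_clinear S" "\<forall>x. S (0 *\<^sub>C x - T x) = x"
    by (elim exE conjE)
  define R where "R x = 0 - S x" for x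
  have R: "bounded_clinear R"
    unfolding R_def by (intro bounded_clinear_minus_fun bounded_clinear_zero_fun S(1))
  have RT: "R (T x) = x" for x
    using S(2)[rule_format, of x] bounded_clinear_diff[OF S(1), of 0 "T x"]
    by (simp add: R_def bounded_clinear_zero[OF S(1)])
  have RTn: "(R ^^ n) ((T ^^ n) x) = x" for n x
    by (induction n arbitrary: x) (simp_all add: funpow_swap1[of T] RT)
  have "x = 0" for x :: 'a
    by (rule funpow_comp_quasinilpotent_eq_0[OF T _ R]) (auto simp: empty RTn)
  then show False using nontrivial by blast
qed

text \<open>The nonzero parts of the two spectra agree. Since \<open>quasinilpotent\<close> demands
  the spectrum to be exactly \<open>{0}\<close>, its nonemptiness must be supplied, which is where a
  nonzero vector enters.\<close>

lemma quasinilpotent_commute: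
  fixes U :: "'b::complex_inner \<Rightarrow> 'a::complex_inner" and V :: "'a \<Rightarrow> 'b"
  assumes U: "bounded_clinear U" and V: "bounded_clinear V"
    and "quasinilpotent (V \<circ> U)" and "\<exists>x :: 'a. x \<noteq> 0"
  shows "quasinilpotent (U \<circ> V)"
proof -
  have "op_spectrum (V \<circ> U) = {0}"
    using assms(3) unfolding quasinilpotent_def .
  then have "op_spectrum (U \<circ> V) \<subseteq> {0}"
    using op_spectrum_commute[OF U V] by auto
  moreover have "op_spectrum (U \<circ> V) \<noteq> {}"
    by (intro op_spectrum_nonempty bounded_clinear_compose U V assms(4))
  ultimately show ?thesis
    unfolding quasinilpotent_def by (metis subset_singletonD)
qed

section \<open>Uniqueness of the generalized Drazin inverse\<close>

text \<open>The idempotents \<open>T S\<close> and \<open>T S'\<close> agree, since their failure to absorb each other is, for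
  every \<open>n\<close>, a product of \<open>S\<^sup>n\<close> with the \<open>n\<close>th power of a quasinilpotent operator.\<close>

lemma gdrazin_idempotents_absorb:
  assumes T: "bounded_clinear T" and S: "is_gdrazin_inverse T S" and S': "is_gdrazin_inverse T S'"
  shows "T (S (T (S' x))) = T (S x)" and "T (S' (T (S x))) = T (S x)"
proof -
  have S_bd: "bounded_clinear S" and S'_bd: "bounded_clinear S'"
    and comm: "\<And>x. T (S x) = S (T x)" and idem: "\<And>x. S (T (S x)) = S x"
    and comm': "\<And>x. T (S' x) = S' (T x)" and idem': "\<And>x. S' (T (S' x)) = S' x"
    and qn: "quasinilpotent (\<lambda>x. T x - (T \<circ> T \<circ> S') x)"
    using S S' unfolding is_gdrazin_inverse_def by (auto simp: fun_eq_iff)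
  \<comment> \<open>\<open>C\<close> is the idempotent complementary to \<open>T S'\<close>; it
    commutes with \<open>T\<close>, and \<open>Q = T C\<close> is the quasinilpotent part of
    \<open>T\<close> belonging to \<open>S'\<close>.\<close>
  define C where "C x = x - T (S' x)" for x
  define Q where "Q x = T x - (T \<circ> T \<circ> S') x" for x
  have Q_bd: "bounded_clinear Q"
    unfolding Q_def by (intro bounded_clinear_minus_fun bounded_clinear_compose T S'_bd)
  have spec: "op_spectrum Q \<subseteq> {0}"
    using qn unfolding quasinilpotent_def Q_def by simp
  have QC: "Q x = T (C x)" for x
    by (simp add: Q_def C_def bounded_clinear_diff[OF T])
  have TC: "T (C x) = C (T x)" for x
    by (simp add: C_def bounded_clinear_diff[OF T] comm')
  have CC: "C (C x) = C x" for x
    unfolding C_def bounded_clinear_diff[OF S'_bd] bounded_clinear_diff[OF T] idem' by simp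
  have Tn_C: "(T ^^ n) (C x) = C ((T ^^ n) x)" for n x
    by (induction n) (simp_all add: TC)
  \<comment> \<open>Exponents start at one, because the zeroth powers would give the identity on the
    left but \<open>C\<close> on the right.\<close>
  have Qn: "(Q ^^ Suc n) x = (T ^^ Suc n) (C x)" for n x
  proof (induction n)
    case (Suc n)
    then have "(Q ^^ Suc (Suc n)) x = Q ((T ^^ Suc n) (C x))" by simp
    also have "\<dots> = (T ^^ Suc (Suc n)) (C (C x))" by (simp only: QC Tn_C[symmetric]) simp
    finally show ?case by (simp only: CC)
  qed (simp add: QC)
  have ST: "(S ^^ Suc n) ((T ^^ Suc n) x) = T (S x)" for n x
  proof (induction n arbitrary: x)
    case (Suc n)
    have "(S ^^ Suc (Suc n)) ((T ^^ Suc (Suc n)) x) = S ((S ^^ Suc n) ((T ^^ Suc n) (T x)))"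
      by (simp add: funpow_swap1)
    also have "\<dots> = T (S x)" using idem[of "T x"] by (simp only: Suc comm)
    finally show ?case .
  qed (simp add: comm)
  have TS: "(T ^^ Suc n) ((S ^^ Suc n) x) = T (S x)" for n x
  proof (induction n arbitrary: x)
    case (Suc n)
    have "(T ^^ Suc (Suc n)) ((S ^^ Suc (Suc n)) x) = T ((T ^^ Suc n) ((S ^^ Suc n) (S x)))"
      by (simp add: funpow_swap1)
    also have "\<dots> = T (S x)" unfolding Suc using comm[of "S x"] idem[of x] by simp
    finally show ?case .
  qed simp
  \<comment> \<open>For \<open>n > 0\<close>,
    \<open>T S C = S\<^sup>n T\<^sup>n C = S\<^sup>n Q\<^sup>n\<close>; the other identity below is
    the mirror image \<open>C T S = Q\<^sup>n S\<^sup>n\<close>.\<close>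
  have "T (S (C x)) = 0"
  proof (rule funpow_comp_quasinilpotent_eq_0[OF Q_bd spec S_bd])
    fix n :: nat assume "n > 0"
    then obtain m where "n = Suc m" by (cases n) auto
    then show "T (S (C x)) = (S ^^ n) ((Q ^^ n) x) \<or> T (S (C x)) = (Q ^^ n) ((S ^^ n) x)"
      by (simp only: Qn ST simp_thms)
  qed
  then show "T (S (T (S' x))) = T (S x)"
    by (simp add: C_def bounded_clinear_diff[OF S_bd] bounded_clinear_diff[OF T])
  have "C (T (S x)) = 0"
  proof (rule funpow_comp_quasinilpotent_eq_0[OF Q_bd spec S_bd])
    fix n :: nat assume "n > 0"
    then obtain m where "n = Suc m" by (cases n) auto
    then show "C (T (S x)) = (S ^^ n) ((Q ^^ n) x) \<or> C (T (S x)) = (Q ^^ n) ((S ^^ n) x)"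
      by (simp only: Qn Tn_C TS simp_thms)
  qed
  then show "T (S' (T (S x))) = T (S x)"
    by (simp add: C_def)
qed

text \<open>Absorption with the roles of \<open>S\<close> and \<open>S'\<close> exchanged gives
  \<open>T S = T S'\<close>; then \<open>S = S T S' = T S' S' = S'\<close>.\<close>

lemma gdrazin_eqI:
  assumes T: "bounded_clinear T" and S: "is_gdrazin_inverse T S"
  shows "gdrazin T = S"
  unfolding gdrazin_def
proof (rule the_equality)
  show "is_gdrazin_inverse T S" by (rule S)
  fix S' assume S': "is_gdrazin_inverse T S'"
  have comm: "\<And>x. T (S x) = S (T x)" and idem: "\<And>x. S (T (S x)) = S x"
    and comm': "\<And>x. T (S' x) = S' (T x)" and idem': "\<And>x. S' (T (S' x)) = S' x"
    using S S' unfolding is_gdrazin_inverse_def by (auto simp: fun_eq_iff)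
  have same: "T (S x) = T (S' x)" for x
    using gdrazin_idempotents_absorb(1)[OF T S S', of x]
      gdrazin_idempotents_absorb(2)[OF T S' S, of x] by simp
  show "S' = S"
  proof
    fix x
    have "S x = S (T (S' x))" using idem[of x] same[of x] by simp
    also have "\<dots> = T (S' (S' x))" unfolding comm[symmetric] same ..
    also have "\<dots> = S' x" using comm'[of "S' x"] idem'[of x] by simp
    finally show "S' x = S x" ..
  qed
qed

section \<open>The weighted core-EP inverse\<close>

text \<open>Serves to show that \<open>M\<close> and \<open>N\<close>, introduced as ranges, are
  closed: each is the fixed-point set of a bounded idempotent.\<close>

lemma closed_subspace_fixed_points:
  fixes p :: "'a::complex_inner \<Rightarrow> 'a"
  assumes p: "bounded_clinear p"
  shows "complex_vector.subspace {x. p x = x}" "closed {x. p x = x}"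
proof -
  show "complex_vector.subspace {x. p x = x}"
    using p by (auto intro!: complex_vector.subspaceI
        simp: bounded_clinear_add bounded_clinear_scaleC bounded_clinear_zero)
  show "closed {x. p x = x}"
    using p unfolding bounded_clinear_def
    by (intro closed_Collect_eq continuous_on_id linear_continuous_on) auto
qed

locale weighted_gdrazin =
  fixes W :: "'y::complex_hilbert_space \<Rightarrow> 'x::complex_hilbert_space"
    and A D :: "'x \<Rightarrow> 'y"
  assumes W_bd: "bounded_clinear W" and A_bd: "bounded_clinear A"
    and D_inv: "is_wgdrazin_inverse W A D"
    and nontrivial: "\<exists>x :: 'x. x \<noteq> 0"
begin

lemma D_bd: "bounded_clinear D"
  and AWD: "A (W (D x)) = D (W (A x))"
  and DWAWD: "D (W (A (W (D x)))) = D x"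
  using D_inv unfolding is_wgdrazin_inverse_def by (auto simp: fun_eq_iff)

text \<open>The weighted definition controls \<open>C \<circ> W\<close> on the codomain of
  \<open>A\<close>, whereas here \<open>W \<circ> C\<close> on its domain matters;
  \<open>quasinilpotent_commute\<close> transfers the property and uses
  \<open>nontrivial\<close>.\<close>

lemma gdrazin_WA: "gdrazin (W \<circ> A) = W \<circ> D"
proof (rule gdrazin_eqI)
  show "bounded_clinear (W \<circ> A)" by (intro bounded_clinear_compose W_bd A_bd)
  define C where "C x = A x - (A \<circ> W \<circ> D \<circ> W \<circ> A) x" for x
  have "bounded_clinear C"
    unfolding C_def by (intro bounded_clinear_minus_fun bounded_clinear_compose A_bd W_bd D_bd)
  moreover have "quasinilpotent (C \<circ> W)"
    using D_inv unfolding is_wgdrazin_inverse_def C_def by (elim conjE)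
  ultimately have "quasinilpotent (W \<circ> C)"
    using quasinilpotent_commute[OF W_bd] nontrivial by blast
  moreover have "W \<circ> C = (\<lambda>x. (W \<circ> A) x - ((W \<circ> A) \<circ> (W \<circ> A) \<circ> (W \<circ> D)) x)"
    by (simp add: fun_eq_iff C_def bounded_clinear_diff[OF W_bd] AWD)
  ultimately show "is_gdrazin_inverse (W \<circ> A) (W \<circ> D)"
    unfolding is_gdrazin_inverse_def
    by (auto simp: fun_eq_iff AWD DWAWD[unfolded AWD] intro!: bounded_clinear_compose W_bd D_bd)
qed

lemma gdrazin_AW: "gdrazin (A \<circ> W) = D \<circ> W"
proof (rule gdrazin_eqI)
  show "bounded_clinear (A \<circ> W)" by (intro bounded_clinear_compose W_bd A_bd)
  have "(\<lambda>x. A x - (A \<circ> W \<circ> D \<circ> W \<circ> A) x) \<circ> W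
      = (\<lambda>x. (A \<circ> W) x - ((A \<circ> W) \<circ> (A \<circ> W) \<circ> (D \<circ> W)) x)"
    by (simp add: fun_eq_iff AWD)
  moreover have "quasinilpotent ((\<lambda>x. A x - (A \<circ> W \<circ> D \<circ> W \<circ> A) x) \<circ> W)"
    using D_inv unfolding is_wgdrazin_inverse_def by (elim conjE)
  ultimately have "quasinilpotent (\<lambda>x. (A \<circ> W) x - ((A \<circ> W) \<circ> (A \<circ> W) \<circ> (D \<circ> W)) x)"
    by (simp only:)
  then show "is_gdrazin_inverse (A \<circ> W) (D \<circ> W)"
    unfolding is_gdrazin_inverse_def
    by (auto simp: fun_eq_iff AWD DWAWD[unfolded AWD] intro!: bounded_clinear_compose W_bd D_bd)
qed

definition "M = range (W \<circ> D)"
definition "N = range (D \<circ> W)"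

text \<open>\<open>W A W D = W D W A\<close> is idempotent with range \<open>M\<close>. The
  fixed-point form provides both closedness and the cancellation rule \<open>WAWD_M\<close>.\<close>

lemma M_eq: "M = {x. W (A (W (D x))) = x}"
proof (intro set_eqI iffI)
  fix x assume "x \<in> M"
  then show "x \<in> {x. W (A (W (D x))) = x}"
    unfolding M_def using AWD DWAWD by auto
next
  fix x assume "x \<in> {x. W (A (W (D x))) = x}"
  then have "x = (W \<circ> D) (W (A x))" by (simp add: AWD)
  then show "x \<in> M" unfolding M_def by blast
qed

lemma N_eq: "N = {y. D (W (A (W y))) = y}"
proof (intro set_eqI iffI)
  fix y assume "y \<in> {y. D (W (A (W y))) = y}"
  then have "y = (D \<circ> W) (A (W y))" by simp
  then show "y \<in> N" unfolding N_def by blast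
qed (auto simp: N_def DWAWD)

lemma WAWD_M: "x \<in> M \<Longrightarrow> W (A (W (D x))) = x"
  and DWAW_N: "y \<in> N \<Longrightarrow> D (W (A (W y))) = y"
  by (auto simp: M_eq N_eq)

lemma D_in_N: "D x \<in> N"
  and W_in_M: "y \<in> N \<Longrightarrow> W y \<in> M"
  and A_in_N: "x \<in> M \<Longrightarrow> A x \<in> N"
  unfolding M_eq N_eq by (simp_all add: AWD DWAWD[unfolded AWD]) (metis AWD)

lemma M_sub: "complex_vector.subspace M" "closed M"
  and N_sub: "complex_vector.subspace N" "closed N"
proof -
  have "bounded_clinear (W \<circ> A \<circ> W \<circ> D)" "bounded_clinear (D \<circ> W \<circ> A \<circ> W)"
    by (intro bounded_clinear_compose W_bd A_bd D_bd)+
  from this[THEN closed_subspace_fixed_points(1)] this[THEN closed_subspace_fixed_points(2)]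
  show "complex_vector.subspace M" "closed M" "complex_vector.subspace N" "closed N"
    unfolding M_eq N_eq by simp_all
qed

abbreviation "P \<equiv> orth_proj M"

lemma P_in_M: "P x \<in> M" by (rule orth_proj_in[OF M_sub])
lemma P_fixed: "x \<in> M \<Longrightarrow> P x = x" by (rule orth_proj_fixed[OF M_sub])
lemma P_bd: "bounded_clinear P" by (rule bounded_clinear_orth_proj[OF M_sub])

text \<open>\<open>W A W\<close> and \<open>D\<close> are mutually inverse between \<open>N\<close>
  and \<open>M\<close>. So \<open>W A W B = P\<close> with range in \<open>N\<close> forces
  \<open>B = D W A W B = D P\<close>.\<close>

lemma weighted_core_EP_eq: "weighted_core_EP W A = D \<circ> P"
  unfolding weighted_core_EP_def gdrazin_WA gdrazin_AW M_def[symmetric] N_def[symmetric]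
proof (rule the_equality)
  show "bounded_clinear (D \<circ> P) \<and> W \<circ> A \<circ> W \<circ> (D \<circ> P) = P \<and> range (D \<circ> P) \<subseteq> N"
    using bounded_clinear_compose[OF D_bd P_bd] D_in_N
    by (auto simp: fun_eq_iff WAWD_M P_in_M)
  fix B assume B: "bounded_clinear B \<and> W \<circ> A \<circ> W \<circ> B = P \<and> range B \<subseteq> N"
  show "B = D \<circ> P"
  proof
    fix x
    have "B x \<in> N" "W (A (W (B x))) = P x" using B by (auto simp: fun_eq_iff)
    then show "B x = (D \<circ> P) x" using DWAW_N[of "B x"] by simp
  qed
qed

section \<open>Solution of the system and its uniqueness\<close>

definition "system_solution x = D (P (W (D (P (W (A x))))))"

text \<open>With \<open>E = D P\<close> this is \<open>A W E W E = E\<close>, and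
  \<open>system_solution\<close> is \<open>E W E W A\<close>. The outer projector acts on a vector
  \<open>W D z\<close>, already in \<open>M\<close>, so \<open>A W D W D = D\<close>
  remains.\<close>

lemma AWDPWDP: "A (W (D (P (W (D (P x)))))) = D (P x)"
  by (simp add: P_fixed W_in_M D_in_N AWD DWAWD[unfolded AWD])

lemma system_solution_solves:
  "bounded_clinear system_solution"
  "A \<circ> W \<circ> system_solution \<circ> W \<circ> system_solution = system_solution"
  "A \<circ> W \<circ> system_solution = weighted_core_EP W A \<circ> W \<circ> A"
proof -
  have "system_solution = D \<circ> P \<circ> W \<circ> D \<circ> P \<circ> W \<circ> A" by (simp add: fun_eq_iff system_solution_def)
  then show "bounded_clinear system_solution"
    by (simp only:) (intro bounded_clinear_compose W_bd A_bd D_bd P_bd)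
  have AW: "A (W (system_solution x)) = D (P (W (A x)))" for x
    unfolding system_solution_def by (rule AWDPWDP)
  then show "A \<circ> W \<circ> system_solution = weighted_core_EP W A \<circ> W \<circ> A"
    by (simp add: fun_eq_iff weighted_core_EP_eq)
  have "P (W (A (W (system_solution x)))) = P (W (D (P (W (A x)))))" for x
    unfolding AW ..
  then show "A \<circ> W \<circ> system_solution \<circ> W \<circ> system_solution = system_solution"
    by (simp add: fun_eq_iff AW) (simp add: system_solution_def)
qed

lemma system_solution_unique:
  assumes "A \<circ> W \<circ> B \<circ> W \<circ> B = B" "A \<circ> W \<circ> B = weighted_core_EP W A \<circ> W \<circ> A"
  shows "B = system_solution"
proof
  fix x
  have AWB: "A (W (B x)) = D (P (W (A x)))" for x
    using assms(2) by (simp add: fun_eq_iff weighted_core_EP_eq)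
  have "B x = A (W (B (W (B x))))" using assms(1) by (simp add: fun_eq_iff)
  \<comment> \<open>The second equation is used first at the argument \<open>W (B x)\<close> and
    then, inside, at \<open>x\<close>.\<close>
  also have "\<dots> = D (P (W (A (W (B x)))))" by (rule AWB)
  also have "\<dots> = system_solution x" unfolding AWB system_solution_def ..
  finally show "B x = system_solution x" .
qed

section \<open>Block representations\<close>

definition "M' = null_space (cadjoint (W \<circ> D))"
definition "N' = null_space (cadjoint (D \<circ> W))"

lemma M'_eq: "M' = {x. \<forall>z\<in>M. cinner x z = 0}"
  and N'_eq: "N' = {x. \<forall>z\<in>N. cinner x z = 0}"
  unfolding M'_def N'_def M_def N_def
  by (intro null_space_cadjoint bounded_clinear_compose W_bd D_bd)+

lemma orth_proj_M': "orth_proj M' x = x - P x"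
  and orth_proj_N': "orth_proj N' y = y - orth_proj N y"
  unfolding M'_eq N'_eq by (rule orth_proj_complement[OF M_sub], rule orth_proj_complement[OF N_sub])

lemma diff_P_in_M': "x - P x \<in> M'"
  and diff_proj_in_N': "y - orth_proj N y \<in> N'"
  unfolding M'_eq N'_eq
  using orth_proj_orthogonal[OF M_sub] orth_proj_orthogonal[OF N_sub] by auto

text \<open>Since \<open>T\<close> maps \<open>L\<close> into \<open>K\<close>, the component in
  \<open>K'\<close> of the image of \<open>L\<close> vanishes; the other entries come from splitting
  \<open>x\<close> and then the image of its \<open>L'\<close> component.\<close>

lemma block_operator_triangular:
  fixes T :: "'a::complex_hilbert_space \<Rightarrow> 'b::complex_hilbert_space"
  assumes T: "bounded_clinear T" and TL: "\<And>x. x \<in> L \<Longrightarrow> T x \<in> K"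
    and L: "complex_vector.subspace L" "closed L" and K: "complex_vector.subspace K" "closed K"
    and L': "L' = {x. \<forall>z\<in>L. cinner x z = 0}" and K': "K' = {x. \<forall>z\<in>K. cinner x z = 0}"
  shows "T = block_operator L L' (block T L K) (block T L' K) (\<lambda>x. 0) (block T L' K')"
proof
  fix x
  have "x - orth_proj L x \<in> L'"
    unfolding L' using orth_proj_orthogonal[OF L] by auto
  moreover have "T x = T (orth_proj L x) + T (x - orth_proj L x)"
    by (simp add: bounded_clinear_diff[OF T])
  ultimately show "T x = block_operator L L' (block T L K) (block T L' K) (\<lambda>x. 0) (block T L' K') x"
    unfolding block_operator_def block_def
      orth_proj_complement[OF L, folded L'] orth_proj_complement[OF K, folded K']
    using orth_proj_in[OF L, of x] by (simp add: orth_proj_fixed[OF K] TL)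
qed

lemma block_A: "A = block_operator M M' (block A M N) (block A M' N) (\<lambda>x. 0) (block A M' N')"
  by (rule block_operator_triangular[OF A_bd A_in_N M_sub N_sub M'_eq N'_eq])

lemma block_W: "W = block_operator N N' (block W N M) (block W N' M) (\<lambda>y. 0) (block W N' M')"
  by (rule block_operator_triangular[OF W_bd W_in_M N_sub M_sub N'_eq M'_eq])

lemma block_A_M: "x \<in> M \<Longrightarrow> block A M N x = A x"
  and block_W_N: "y \<in> N \<Longrightarrow> block W N M y = W y"
  by (simp_all add: block_def orth_proj_fixed[OF N_sub] P_fixed A_in_N W_in_M)

text \<open>The inverse is explicit: \<open>W D W A = W A W D\<close> is the identity on
  \<open>M\<close> and \<open>A W D W = D W A W\<close> is the identity on \<open>N\<close>. For the
  block of \<open>W\<close> the inverse is \<open>A W D\<close>.\<close>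

lemma bij_block_A: "bij_betw (block A M N) M N"
proof (rule bij_betwI[where g = "\<lambda>y. W (D (W y))"])
  show "block A M N \<in> M \<rightarrow> N" by (simp add: block_A_M A_in_N)
  show "(\<lambda>y. W (D (W y))) \<in> N \<rightarrow> M" by (simp add: W_in_M D_in_N)
  show "W (D (W (block A M N x))) = x" if "x \<in> M" for x
    using WAWD_M[OF that] that by (simp add: block_A_M AWD)
  show "block A M N (W (D (W y))) = y" if "y \<in> N" for y
    using DWAW_N[OF that] by (simp add: block_A_M W_in_M D_in_N AWD)
qed

lemma bij_block_W: "bij_betw (block W N M) N M"
proof (rule bij_betwI[where g = "\<lambda>x. A (W (D x))"])
  show "block W N M \<in> N \<rightarrow> M" by (simp add: block_W_N W_in_M)
  show "(\<lambda>x. A (W (D x))) \<in> M \<rightarrow> N" by (simp add: A_in_N W_in_M D_in_N)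
  show "A (W (D (block W N M y))) = y" if "y \<in> N" for y
    using DWAW_N[OF that] that by (simp add: block_W_N AWD)
  show "block W N M (A (W (D x))) = x" if "x \<in> M" for x
    using WAWD_M[OF that] by (simp add: block_W_N A_in_N W_in_M D_in_N)
qed

text \<open>Identifies the inverse in the first block of the solution: \<open>W1 A1 W1\<close> acts
  as \<open>W A W\<close> on \<open>N\<close>, which \<open>D\<close> inverts. Similarly
  \<open>inv_AW\<close> identifies the inverse of \<open>A1 W1\<close> with \<open>D W\<close> on
  \<open>N\<close>.\<close>

lemma inv_WAW:
  assumes "x \<in> M"
  shows "inv_into N (block W N M \<circ> block A M N \<circ> block W N M) x = D x"
proof (rule inv_into_f_eq)
  have eq: "(block W N M \<circ> block A M N \<circ> block W N M) y = W (A (W y))" if "y \<in> N" for y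
    using that by (simp add: block_W_N block_A_M W_in_M A_in_N)
  show "inj_on (block W N M \<circ> block A M N \<circ> block W N M) N"
    by (rule inj_onI) (metis eq DWAW_N)
  show "(block W N M \<circ> block A M N \<circ> block W N M) (D x) = x"
    using assms by (simp only: eq[OF D_in_N] WAWD_M)
qed (rule D_in_N)

lemma inv_AW:
  assumes "y \<in> N"
  shows "inv_into N (block A M N \<circ> block W N M) y = D (W y)"
proof (rule inv_into_f_eq)
  have eq: "(block A M N \<circ> block W N M) y = A (W y)" if "y \<in> N" for y
    using that by (simp add: block_W_N block_A_M W_in_M)
  show "inj_on (block A M N \<circ> block W N M) N"
    by (rule inj_onI) (metis eq DWAW_N)
  show "(block A M N \<circ> block W N M) (D (W y)) = y"
    using DWAW_N[OF assms] by (simp only: eq[OF D_in_N] AWD)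
qed (rule D_in_N)

text \<open>Both sides are compared on the components \<open>u\<close> in \<open>M\<close> and
  \<open>v\<close> in \<open>M'\<close>. For \<open>v\<close> the key fact is that
  \<open>A2 v + W1\<^sup>-\<^sup>1 W2 A3 v\<close> is the vector of \<open>N\<close> that
  \<open>W\<close> maps to \<open>P W A v\<close>.\<close>

lemma system_solution_block:
  "system_solution = block_operator M M'
     (inv_into N (block W N M \<circ> block A M N \<circ> block W N M))
     (\<lambda>x. (inv_into N (block A M N \<circ> block W N M) ^^ 2)
        (block A M' N x + inv_into N (block W N M) (block W N' M (block A M' N' x))))
     (\<lambda>x. 0) (\<lambda>x. 0)"
  (is "_ = block_operator _ _ _ ?B2 _ _")
proof
  fix x
  define u where "u = P x"
  define v where "v = x - P x"
  have proj: "P x = u" "orth_proj M' x = v"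
    by (simp_all add: u_def v_def orth_proj_M')
  have uM: "u \<in> M" and vM': "v \<in> M'"
    unfolding u_def v_def by (rule P_in_M, rule diff_P_in_M')
  \<comment> \<open>On \<open>M\<close> every projector acts as the identity, leaving
    \<open>D W D W A u = D W A W D u = D u\<close>.\<close>
  have sol_u: "system_solution u = D u"
    using uM by (simp add: system_solution_def P_fixed W_in_M A_in_N D_in_N AWD[symmetric] WAWD_M)
  define a where "a = block A M' N v"
  define b where "b = inv_into N (block W N M) (block W N' M (block A M' N' v))"
  have a: "a = orth_proj N (A v)" using vM' by (simp add: a_def block_def)
  have aN: "a \<in> N" unfolding a by (rule orth_proj_in[OF N_sub])
  have A3: "block A M' N' v = A v - a"
    using vM' by (simp add: block_def orth_proj_N' a)
  have W2: "block W N' M (block A M' N' v) = P (W (A v - a))"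
    unfolding A3 using diff_proj_in_N'[of "A v"] by (simp add: block_def a)
  have bN: "b \<in> N" and Wb: "W b = P (W (A v - a))"
  proof -
    have surj: "P (W (A v - a)) \<in> block W N M ` N"
      using bij_block_W P_in_M by (simp add: bij_betw_def)
    show bN: "b \<in> N" unfolding b_def W2 by (rule inv_into_into[OF surj])
    then show "W b = P (W (A v - a))"
      using f_inv_into_f[OF surj] block_W_N[OF bN] unfolding b_def W2 by simp
  qed
  \<comment> \<open>\<open>W a\<close> lies in \<open>M\<close> and is fixed by \<open>P\<close>, so
    it cancels against the term subtracted inside the projection.\<close>
  have "W (a + b) = W a + P (W (A v) - W a)"
    by (simp add: bounded_clinear_add[OF W_bd] Wb bounded_clinear_diff[OF W_bd])
  also have "\<dots> = P (W (A v))"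
    by (simp add: bounded_clinear_diff[OF P_bd] P_fixed[OF W_in_M[OF aN]])
  finally have Wab: "W (a + b) = P (W (A v))" .
  have abN: "a + b \<in> N" using aN bN by (rule complex_vector.subspace_add[OF N_sub(1)])
  \<comment> \<open>Each inverse of \<open>A1 W1\<close> contributes one \<open>D W\<close>; the
    projector missing between them fixes \<open>W D (P (W (A v)))\<close>, which is in
    \<open>M\<close>.\<close>
  have "?B2 v = D (W (D (W (a + b))))"
    unfolding a_def[symmetric] b_def[symmetric]
    by (simp add: numeral_2_eq_2 inv_AW abN D_in_N)
  also have "\<dots> = system_solution v"
    unfolding Wab system_solution_def by (simp add: P_fixed W_in_M D_in_N)
  finally have sol_v: "?B2 v = system_solution v" .
  have "x = u + v" by (simp add: u_def v_def)
  then have "system_solution x = system_solution u + system_solution v"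
    using bounded_clinear_add[OF system_solution_solves(1)] by blast
  then show "system_solution x = block_operator M M'
     (inv_into N (block W N M \<circ> block A M N \<circ> block W N M)) ?B2 (\<lambda>x. 0) (\<lambda>x. 0) x"
    unfolding block_operator_def proj
    by (simp only: inv_WAW[OF uM] sol_u sol_v) simp
qed

end

theorem theorem2p1:
  fixes A :: "'x::complex_hilbert_space \<Rightarrow> 'y::complex_hilbert_space"
    and W :: "'y \<Rightarrow> 'x"
    and M M' :: "'x set" and N N' :: "'y set"
    and A1 A2 A3 :: "'x \<Rightarrow> 'y" and W1 W2 W3 :: "'y \<Rightarrow> 'x"
  assumes "infinite_dimensional TYPE('x)" and "infinite_dimensional TYPE('y)"
    and "bounded_clinear W" and "W \<noteq> (\<lambda>y. 0)"
    and "bounded_clinear A" and "wgdrazin_invertible W A"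
    and "M = range (gdrazin (W \<circ> A))" and "M' = null_space (cadjoint (gdrazin (W \<circ> A)))"
    and "N = range (gdrazin (A \<circ> W))" and "N' = null_space (cadjoint (gdrazin (A \<circ> W)))"
    and "A1 = block A M N" and "A2 = block A M' N" and "A3 = block A M' N'"
    and "W1 = block W N M" and "W2 = block W N' M" and "W3 = block W N' M'"
  shows "(A = block_operator M M' A1 A2 (\<lambda>x. 0) A3 \<and> bij_betw A1 M N \<and>
          W = block_operator N N' W1 W2 (\<lambda>y. 0) W3 \<and> bij_betw W1 N M) \<and>
    (\<exists>!B. bounded_clinear B \<and>
       A \<circ> W \<circ> B \<circ> W \<circ> B = B \<and> A \<circ> W \<circ> B = weighted_core_EP W A \<circ> W \<circ> A) \<and>
    (\<forall>B. bounded_clinear B \<and>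
       A \<circ> W \<circ> B \<circ> W \<circ> B = B \<and> A \<circ> W \<circ> B = weighted_core_EP W A \<circ> W \<circ> A \<longrightarrow>
       B = block_operator M M'
         (inv_into N (W1 \<circ> A1 \<circ> W1))
         (\<lambda>x. (inv_into N (A1 \<circ> W1) ^^ 2) (A2 x + inv_into N W1 (W2 (A3 x))))
         (\<lambda>x. 0)
         (\<lambda>x. 0))"
proof -
  obtain D where D: "is_wgdrazin_inverse W A D"
    using assms(6) unfolding wgdrazin_invertible_def by blast
  have "\<exists>x :: 'x. x \<noteq> 0"
  proof (rule ccontr)
    assume "\<not> (\<exists>x :: 'x. x \<noteq> 0)"
    then have "complex_vector.span {} = (UNIV :: 'x set)" by auto
    then show False using assms(1) unfolding infinite_dimensional_def by blast
  qed
  then interpret weighted_gdrazin W A D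
    using assms(3,5) D by unfold_locales
  \<comment> \<open>Identifies the ranges and null spaces of the generalized Drazin inverses with
    the subspaces built from the chosen \<open>D\<close>.\<close>
  have sets: "M = weighted_gdrazin.M W D" "N = weighted_gdrazin.N W D"
    "M' = weighted_gdrazin.M' W D" "N' = weighted_gdrazin.N' W D"
    unfolding assms(7-10) gdrazin_WA gdrazin_AW M_def N_def M'_def N'_def by simp_all
  have "B = system_solution" if "bounded_clinear B \<and> A \<circ> W \<circ> B \<circ> W \<circ> B = B \<and>
      A \<circ> W \<circ> B = weighted_core_EP W A \<circ> W \<circ> A" for B
    using that by (intro system_solution_unique) auto
  note unique = this this[unfolded system_solution_block]
  show ?thesis
    unfolding assms(11-16) sets
    by (intro conjI allI impI ex1I[of _ system_solution])
      (rule block_A block_W bij_block_A bij_block_W system_solution_solves | erule unique)+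
qed

end
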